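(* Let $G$ be a compact Hausdorff topological group such that the set $X=\{x\in G : x^3=1\}$ has positive Haar measure. Then $G$ contains an open normal $2$-Engel subgroup.
   Context: Haar measure is the normalized Haar measure of $G$. With $[a,b]=a^{-1}b^{-1}ab$ and $[a,b,c]=[[a,b],c]$, a group $H$ is $2$-Engel if $[a,b,b]=1$ for all $a,b\in H$. *)

theory Defs
  imports "HOL-Algebra.Coset" "HOL-Analysis.Analysis"
begin

locale topological_group = group G for G (structure) +
  fixes T :: "'a topology"
  assumes topspace_eq_carrier: "topspace T = carrier G"
    and continuous_mult: "continuous_map (prod_topology T T) T (\<lambda>(x, y). x \<otimes> y)"
    and continuous_inv: "continuous_map T T (\<lambda>x. inv x)"

text \<open>
  On a compact group the left-invariant regular Borel probability measure is unique
  and also right-invariant, so left-invariance suffices. Regularity has to be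
  required explicitly, since the topology need not be metrizable.
\<close>

locale normalized_haar_measure = topological_group G T for G (structure) and T +
  fixes M :: "'a measure"
  assumes space_eq_carrier: "space M = carrier G"
    and sets_eq_borel: "sets M = sigma_sets (carrier G) {U. openin T U}"
    and normalized: "emeasure M (carrier G) = 1"
    and left_invariant:
      "\<And>g A. g \<in> carrier G \<Longrightarrow> A \<in> sets M \<Longrightarrow> emeasure M (g <# A) = emeasure M A"
    and outer_regular:
      "\<And>A. A \<in> sets M \<Longrightarrow>
        emeasure M A = (INF U\<in>{U. openin T U \<and> A \<subseteq> U}. emeasure M U)"
    and inner_regular:
      "\<And>U. openin T U \<Longrightarrow>
        emeasure M U = (SUP K\<in>{K. compactin T K \<and> K \<subseteq> U}. emeasure M K)"

definition commutator :: "('a, 'b) monoid_scheme \<Rightarrow> 'a \<Rightarrow> 'a \<Rightarrow> 'a" where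
  "commutator G a b = inv\<^bsub>G\<^esub> a \<otimes>\<^bsub>G\<^esub> inv\<^bsub>G\<^esub> b \<otimes>\<^bsub>G\<^esub> a \<otimes>\<^bsub>G\<^esub> b"

definition two_Engel :: "('a, 'b) monoid_scheme \<Rightarrow> bool" where
  "two_Engel H \<longleftrightarrow> group H \<and>
    (\<forall>a\<in>carrier H. \<forall>b\<in>carrier H. commutator H (commutator H a b) b = \<one>\<^bsub>H\<^esub>)"

end

theory Submission
  imports Defs "HOL-Algebra.Generated_Groups"
begin

text \<open>
  Let \<open>X\<close> be the set of solutions of \<open>x\<^sup>3 = \<one>\<close>. By outer regularity there is a neighbourhood \<open>U\<close> of
  \<open>\<one>\<close> such that for any eight elements of \<open>U\<close> a single \<open>x\<close> satisfies \<open>(w x)\<^sup>3 = \<one>\<close> for all of them.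
  Applied to suitable words \<open>w\<close> in \<open>u\<close> and \<open>v\<close>, this forces \<open>u\<close> to commute with \<open>v\<inverse> u v\<close>, so \<open>G\<close> is
  2-Engel near \<open>\<one>\<close>. The proof that 2-Engel groups have class at most 3 uses only words of bounded
  length, so it works locally as well: on a small conjugation-invariant neighbourhood \<open>V\<close> all
  fourfold commutators vanish and \<open>[[a, b], c]\<close> is alternating. Both facts pass from \<open>V\<close> to the
  open normal subgroup it generates.
\<close>

subsection \<open>Cubes in a coset\<close>

context group
begin

section \<open>Conjugation and commutator identities valid in every group\<close>

lemma mult_inv_cancel_left [simp]:
  assumes "a \<in> carrier G" "b \<in> carrier G"
  shows "a \<otimes> (inv a \<otimes> b) = b" "inv a \<otimes> (a \<otimes> b) = b"
  using assms by (simp_all flip: m_assoc)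

lemma commutator_closed [simp, intro]:
  "a \<in> carrier G \<Longrightarrow> b \<in> carrier G \<Longrightarrow> commutator G a b \<in> carrier G"
  by (simp add: commutator_def)

lemma inv_commutator:
  "a \<in> carrier G \<Longrightarrow> b \<in> carrier G \<Longrightarrow> inv (commutator G a b) = commutator G b a"
  by (simp add: commutator_def inv_mult_group m_assoc)

lemma commutator_eq_one_iff:
  assumes "a \<in> carrier G" "b \<in> carrier G"
  shows "commutator G a b = \<one> \<longleftrightarrow> a \<otimes> b = b \<otimes> a"
proof -
  have "commutator G a b = inv (b \<otimes> a) \<otimes> (a \<otimes> b)"
    using assms by (simp add: commutator_def inv_mult_group m_assoc)
  then show ?thesis
    using assms by (metis inv_closed inv_equality inv_inv l_inv m_closed)
qed

lemma commutator_mult_left: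
  assumes "a \<in> carrier G" "b \<in> carrier G" "c \<in> carrier G"
  shows "commutator G (a \<otimes> b) c = inv b \<otimes> commutator G a c \<otimes> b \<otimes> commutator G b c"
  using assms by (simp add: commutator_def inv_mult_group m_assoc)

lemma commutator_mult_right:
  assumes "a \<in> carrier G" "b \<in> carrier G" "c \<in> carrier G"
  shows "commutator G a (b \<otimes> c) = commutator G a c \<otimes> (inv c \<otimes> commutator G a b \<otimes> c)"
  using assms by (simp add: commutator_def inv_mult_group m_assoc)

lemma conj_eq_mult_commutator:
  assumes "a \<in> carrier G" "b \<in> carrier G"
  shows "inv b \<otimes> a \<otimes> b = a \<otimes> commutator G a b"
  using assms by (simp add: commutator_def m_assoc)

lemma conj_eq_self:
  assumes "a \<in> carrier G" "b \<in> carrier G" "a \<otimes> b = b \<otimes> a"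
  shows "inv b \<otimes> a \<otimes> b = a"
  using assms by (simp add: m_assoc)

lemma commute_inv:
  assumes "a \<in> carrier G" "b \<in> carrier G" "a \<otimes> b = b \<otimes> a"
  shows "inv a \<otimes> b = b \<otimes> inv a"
  using assms by (metis inv_closed m_assoc mult_inv_cancel_left(2) r_inv r_one m_closed)

lemma commute_mult:
  assumes "a \<in> carrier G" "b \<in> carrier G" "c \<in> carrier G"
    and "a \<otimes> c = c \<otimes> a" "b \<otimes> c = c \<otimes> b"
  shows "(a \<otimes> b) \<otimes> c = c \<otimes> (a \<otimes> b)"
  using assms by (metis m_assoc)

lemma commutator_inv_left:
  assumes "a \<in> carrier G" "b \<in> carrier G"
    and "commutator G a b \<otimes> a = a \<otimes> commutator G a b"
  shows "commutator G (inv a) b = inv (commutator G a b)"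
proof -
  have "commutator G (inv a) b = a \<otimes> inv (commutator G a b) \<otimes> inv a"
    using assms(1,2) by (simp add: commutator_def inv_mult_group m_assoc)
  also have "\<dots> = inv (commutator G a b)"
    using commute_inv[OF _ _ assms(3)] assms(1,2)
    by (metis commutator_closed inv_closed m_assoc r_inv r_one)
  finally show ?thesis .
qed

lemma conj_eq_one:
  assumes "v \<in> carrier G" "z \<in> carrier G" "\<one> = v \<otimes> z \<otimes> inv v"
  shows "z = \<one>"
proof -
  have "z = inv v \<otimes> (v \<otimes> z \<otimes> inv v) \<otimes> v"
    using assms(1,2) by (simp add: m_assoc)
  then show ?thesis
    using assms(1) by (simp flip: assms(3))
qed

text \<open>Since \<open>x^3 = 1\<close>, the factor \<open>x^-2\<close> in the middle of the
  product of conjugates equals \<open>x\<close>, which turns the product into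
  \<open>u x u x u x\<close>.\<close>

lemma cube_mult_eq_one_iff:
  assumes "x \<in> carrier G" "u \<in> carrier G" "x \<otimes> x \<otimes> x = \<one>"
  shows "(u \<otimes> x) [^] (3::nat) = \<one> \<longleftrightarrow> u \<otimes> (x \<otimes> u \<otimes> inv x) \<otimes> (inv x \<otimes> u \<otimes> x) = \<one>"
proof -
  have "inv x = x \<otimes> x"
    using assms by (metis inv_equality m_closed)
  then have "u \<otimes> (x \<otimes> u \<otimes> inv x) \<otimes> (inv x \<otimes> u \<otimes> x) = u \<otimes> x \<otimes> u \<otimes> (x \<otimes> x \<otimes> x) \<otimes> x \<otimes> u \<otimes> x"
    using assms(1,2) by (simp add: m_assoc)
  also have "\<dots> = (u \<otimes> x) [^] (3::nat)"
    using assms by (simp add: numeral_3_eq_3 m_assoc)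
  finally show ?thesis by simp
qed

text \<open>
  With \<open>u' = x u x\<inverse>\<close> and \<open>u'' = x\<inverse> u x\<close>, the cube relation for \<open>u x\<close> reads \<open>u u' u'' = \<one>\<close>.
  Comparing it for \<open>v\<close>, \<open>u v\<close> and \<open>u\<inverse> v\<close> gives a relation \<open>s t r = \<one>\<close> with \<open>s = v\<inverse> u v\<close> and
  \<open>t = u'\<close>, and also its counterpart \<open>s\<inverse> t\<inverse> r\<inverse> = \<one>\<close>, whence \<open>s t = t s\<close>.
\<close>
lemma conj_commute_if_cubes:
  assumes [simp]: "x \<in> carrier G" "u \<in> carrier G" "v \<in> carrier G"
    and x: "x \<otimes> x \<otimes> x = \<one>"
    and cubes: "(v \<otimes> x) [^] (3::nat) = \<one>" "(u \<otimes> v \<otimes> x) [^] (3::nat) = \<one>"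
      "(inv u \<otimes> v \<otimes> x) [^] (3::nat) = \<one>"
  shows "(inv v \<otimes> u \<otimes> v) \<otimes> (x \<otimes> u \<otimes> inv x) = (x \<otimes> u \<otimes> inv x) \<otimes> (inv v \<otimes> u \<otimes> v)"
proof -
  \<comment> \<open>The relation for \<open>v\<close> gives \<open>v'' = (v v')^-1\<close>, so in
    the relation for \<open>a v\<close> the factor \<open>a''\<close> ends up conjugated by
    \<open>v'\<close>; \<open>r a\<close> is that conjugate. It is multiplicative in
    \<open>a\<close>, hence \<open>r (inv u)\<close> is the inverse of \<open>r u\<close>.\<close>
  define r where "r a = (x \<otimes> v \<otimes> inv x) \<otimes> (inv x \<otimes> a \<otimes> x) \<otimes> inv (x \<otimes> v \<otimes> inv x)" for a
  have v'': "inv x \<otimes> v \<otimes> x = inv (v \<otimes> (x \<otimes> v \<otimes> inv x))"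
  proof -
    have "v \<otimes> (x \<otimes> v \<otimes> inv x) \<otimes> (inv x \<otimes> v \<otimes> x) = \<one>"
      using cubes(1) cube_mult_eq_one_iff x by simp
    then show ?thesis
      by (metis assms(1,3) inv_closed inv_comm inv_equality m_closed)
  qed
  have rel: "(inv v \<otimes> a \<otimes> v) \<otimes> (x \<otimes> a \<otimes> inv x) \<otimes> r a = \<one>"
    if [simp]: "a \<in> carrier G" and "(a \<otimes> v \<otimes> x) [^] (3::nat) = \<one>" for a
  proof -
    have "\<one> = (a \<otimes> v) \<otimes> (x \<otimes> (a \<otimes> v) \<otimes> inv x) \<otimes> (inv x \<otimes> (a \<otimes> v) \<otimes> x)"
      using that cube_mult_eq_one_iff[of x "a \<otimes> v"] x by simp
    also have "\<dots> = (a \<otimes> v) \<otimes> (x \<otimes> a \<otimes> inv x) \<otimes> (x \<otimes> v \<otimes> inv x) \<otimes> (inv x \<otimes> a \<otimes> x) \<otimes> (inv x \<otimes> v \<otimes> x)"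
      by (simp add: m_assoc)
    also have "\<dots> = v \<otimes> ((inv v \<otimes> a \<otimes> v) \<otimes> (x \<otimes> a \<otimes> inv x) \<otimes> r a) \<otimes> inv v"
      unfolding v'' r_def by (simp add: m_assoc inv_mult_group)
    finally have "\<one> = v \<otimes> ((inv v \<otimes> a \<otimes> v) \<otimes> (x \<otimes> a \<otimes> inv x) \<otimes> r a) \<otimes> inv v" .
    then show ?thesis
      by (intro conj_eq_one) (auto simp: r_def)
  qed
  have [simp]: "r u \<in> carrier G" by (simp add: r_def)
  have "(inv v \<otimes> u \<otimes> v) \<otimes> (x \<otimes> u \<otimes> inv x) = inv (r u)"
    using rel[of u] cubes(2) by (simp add: inv_equality)
  \<comment> \<open>The relation for \<open>inv u\<close> is the inverted form of
    \<open>r t s = 1\<close>. So \<open>s t\<close> and \<open>t s\<close> are both the inverse of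
    \<open>r u\<close>.\<close>
  moreover have "inv (r u \<otimes> (x \<otimes> u \<otimes> inv x) \<otimes> (inv v \<otimes> u \<otimes> v)) = \<one>"
    using rel[of "inv u"] cubes(3) by (simp add: r_def m_assoc inv_mult_group)
  then have "r u \<otimes> ((x \<otimes> u \<otimes> inv x) \<otimes> (inv v \<otimes> u \<otimes> v)) = \<one>"
    by (simp add: inv_eq_1_iff m_assoc)
  then have "(x \<otimes> u \<otimes> inv x) \<otimes> (inv v \<otimes> u \<otimes> v) = inv (r u)"
    by (metis \<open>r u \<in> carrier G\<close> assms(1-3) inv_closed inv_comm inv_equality m_closed)
  ultimately show ?thesis by simp
qed

text \<open>The two cubes are inverse to each other up to conjugation by \<open>w\<close>. This
  allows \<open>x\<close> to be replaced by \<open>inv x\<close> in the cube relations.\<close>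

lemma cube_eq_one_mult_inv:
  assumes [simp]: "x \<in> carrier G" "w \<in> carrier G" and "(inv w \<otimes> x) [^] (3::nat) = \<one>"
  shows "(w \<otimes> inv x) [^] (3::nat) = \<one>"
proof -
  have "(w \<otimes> inv x) [^] (3::nat) = w \<otimes> inv ((inv w \<otimes> x) [^] (3::nat)) \<otimes> inv w"
    by (simp add: numeral_3_eq_3 m_assoc inv_mult_group)
  with assms(3) show ?thesis by simp
qed

text \<open>The conjugate of \<open>u\<close> by \<open>v\<close> commutes with
  \<open>x u x^-1\<close>, and, with \<open>inv x\<close> in place of \<open>x\<close>, also with
  \<open>x^-1 u x\<close>. The cube relation for \<open>u\<close> makes \<open>u\<close> the inverse
  of the product of these two. Of the eight words, \<open>\<one>\<close> gives
  \<open>x^3 = 1\<close>, \<open>u\<close> this last relation, and three words each serve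
  \<open>x\<close> and \<open>inv x\<close>.\<close>

lemma commute_conj_if_cubes:
  assumes [simp]: "x \<in> carrier G" "u \<in> carrier G" "v \<in> carrier G"
    and cubes: "\<And>w. w \<in> {\<one>, u, v, u \<otimes> v, inv u \<otimes> v, inv v, inv v \<otimes> inv u, inv v \<otimes> u} \<Longrightarrow>
      (w \<otimes> x) [^] (3::nat) = \<one>"
  shows "(inv v \<otimes> u \<otimes> v) \<otimes> u = u \<otimes> (inv v \<otimes> u \<otimes> v)"
proof -
  let ?c = "inv v \<otimes> u \<otimes> v" and ?p = "x \<otimes> u \<otimes> inv x" and ?q = "inv x \<otimes> u \<otimes> x"
  have x: "x \<otimes> x \<otimes> x = \<one>"
    using cubes[of \<one>] by (simp add: numeral_3_eq_3)
  have x': "inv x \<otimes> inv x \<otimes> inv x = \<one>"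
    using arg_cong[OF x, of "m_inv G"] by (simp add: inv_mult_group m_assoc)
  have p: "?p \<otimes> ?c = ?c \<otimes> ?p"
    using x cubes by (intro conj_commute_if_cubes[symmetric]) auto
  have cubes': "(w \<otimes> inv x) [^] (3::nat) = \<one>" if "w \<in> {v, u \<otimes> v, inv u \<otimes> v}" for w
    using that by (intro cube_eq_one_mult_inv cubes) (auto simp: inv_mult_group)
  have "?c \<otimes> (inv x \<otimes> u \<otimes> inv (inv x)) = (inv x \<otimes> u \<otimes> inv (inv x)) \<otimes> ?c"
    using x' cubes' by (intro conj_commute_if_cubes) auto
  then have q: "?q \<otimes> ?c = ?c \<otimes> ?q" by simp
  have "u \<otimes> (?p \<otimes> ?q) = \<one>"
    using cubes[of u] cube_mult_eq_one_iff[of x u] x by (simp add: m_assoc)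
  then have "u = inv (?p \<otimes> ?q)"
    by (intro inv_equality[symmetric]) auto
  with commute_inv[OF _ _ commute_mult[OF _ _ _ p q]] show ?thesis by simp
qed

end

subsection \<open>Local 2-Engel conditions\<close>

text \<open>Words of exactly \<open>n\<close> letters suffice: once \<open>V\<close> contains the
  identity, these sets increase with \<open>n\<close>.\<close>

fun word_ball :: "('a, 'b) monoid_scheme \<Rightarrow> 'a set \<Rightarrow> nat \<Rightarrow> 'a set" where
  "word_ball G V 0 = {\<one>\<^bsub>G\<^esub>}"
| "word_ball G V (Suc n) = {a \<otimes>\<^bsub>G\<^esub> b | a b. a \<in> word_ball G V n \<and> b \<in> V}"

lemma (in group) generate_commute:
  assumes "p \<in> generate G S" "S \<subseteq> carrier G" "c \<in> carrier G"
    and "\<And>s. s \<in> S \<Longrightarrow> s \<otimes> c = c \<otimes> s"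
  shows "p \<otimes> c = c \<otimes> p"
  using assms(1)
proof induction
  case (inv h)
  then show ?case using assms by (intro commute_inv) auto
next
  case (eng h1 h2)
  then show ?case
    using assms generate_in_carrier by (intro commute_mult) auto
qed (use assms in auto)

section \<open>Word balls of a symmetric set and local normal closures\<close>

locale symmetric_subset = group G for G (structure) +
  fixes V :: "'a set"
  assumes subset_carrier: "V \<subseteq> carrier G"
    and one_mem: "\<one> \<in> V"
    and inv_mem: "a \<in> V \<Longrightarrow> inv a \<in> V"
begin

abbreviation ball :: "nat \<Rightarrow> 'a set" where
  "ball \<equiv> word_ball G V"

lemma ball_closed: "a \<in> ball n \<Longrightarrow> a \<in> carrier G"
  using subset_carrier by (induction n arbitrary: a) auto

lemma ball_mult:
  assumes "a \<in> ball m" "b \<in> ball n"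
  shows "a \<otimes> b \<in> ball (m + n)"
  using assms(2)
proof (induction n arbitrary: b)
  case 0
  then show ?case using assms(1) ball_closed by simp
next
  case (Suc n)
  then obtain c d where b: "b = c \<otimes> d" "c \<in> ball n" "d \<in> V"
    by auto
  then have "a \<otimes> b = (a \<otimes> c) \<otimes> d"
    using assms(1) ball_closed subset_carrier by (auto simp: m_assoc)
  then show ?case using Suc.IH[OF b(2)] b(3) by auto
qed

lemma mem_ball_one: "a \<in> V \<Longrightarrow> a \<in> ball 1"
  using subset_carrier by (force intro: l_one[symmetric])

lemma ball_mono:
  assumes "m \<le> n"
  shows "ball m \<subseteq> ball n"
proof (rule lift_Suc_mono_le[OF _ assms])
  fix k
  show "ball k \<subseteq> ball (Suc k)"
    using one_mem ball_closed by (force intro: r_one[symmetric])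
qed

lemma ball_inv: "a \<in> ball n \<Longrightarrow> inv a \<in> ball n"
proof (induction n arbitrary: a)
  case (Suc n)
  then obtain b c where a: "a = b \<otimes> c" "b \<in> ball n" "c \<in> V"
    by auto
  then have "inv a = inv c \<otimes> inv b"
    using ball_closed subset_carrier by (auto simp: inv_mult_group)
  then show ?case
    using ball_mult[OF mem_ball_one[OF inv_mem] Suc.IH] a by simp
qed simp

declare word_ball.simps(2) [simp del]

lemma ball_commutator:
  "a \<in> ball m \<Longrightarrow> b \<in> ball n \<Longrightarrow> commutator G a b \<in> ball (m + n + m + n)"
  unfolding commutator_def by (intro ball_mult ball_inv)

text \<open>A substitute for the normal closure of \<open>a\<close> that only involves short conjugators.\<close>
definition conj_span :: "'a \<Rightarrow> nat \<Rightarrow> 'a set" where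
  "conj_span a n = generate G ((\<lambda>g. inv g \<otimes> a \<otimes> g) ` ball n)"

lemma conj_span_subgroup:
  assumes "a \<in> carrier G"
  shows "subgroup (conj_span a n) G"
  unfolding conj_span_def using assms ball_closed
  by (intro generate_is_subgroup) auto

lemma conj_span_closed: "a \<in> carrier G \<Longrightarrow> p \<in> conj_span a n \<Longrightarrow> p \<in> carrier G"
  by (rule subgroup.mem_carrier[OF conj_span_subgroup])

lemma conj_span_mult:
  "a \<in> carrier G \<Longrightarrow> p \<in> conj_span a n \<Longrightarrow> q \<in> conj_span a n \<Longrightarrow> p \<otimes> q \<in> conj_span a n"
  by (rule subgroup.m_closed[OF conj_span_subgroup])

lemma conj_span_inv:
  "a \<in> carrier G \<Longrightarrow> p \<in> conj_span a n \<Longrightarrow> inv p \<in> conj_span a n"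
  by (rule subgroup.m_inv_closed[OF conj_span_subgroup])

lemma conj_span_mono: "m \<le> n \<Longrightarrow> conj_span a m \<subseteq> conj_span a n"
  unfolding conj_span_def by (intro mono_generate image_mono ball_mono)

lemma self_mem_conj_span: "a \<in> carrier G \<Longrightarrow> a \<in> conj_span a n"
  unfolding conj_span_def using ball_mono[of 0 n]
  by (intro generate.incl image_eqI[of _ _ \<one>]) auto

text \<open>Conjugating by \<open>h\<close> replaces each conjugator \<open>g\<close> by
  \<open>g h\<close>, so only the length of \<open>h\<close> is added to the index.\<close>

lemma conj_span_conj:
  assumes a: "a \<in> carrier G" and h: "h \<in> ball m" and p: "p \<in> conj_span a n"
  shows "inv h \<otimes> p \<otimes> h \<in> conj_span a (n + m)"
proof -
  note [simp] = a ball_closed[OF h]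
  let ?S = "(\<lambda>g. inv g \<otimes> a \<otimes> g) ` ball n"
  have gen: "inv h \<otimes> q \<otimes> h \<in> conj_span a (n + m)" if "q \<in> ?S" for q
  proof -
    from that obtain g where g: "g \<in> ball n" and q: "q = inv g \<otimes> a \<otimes> g"
      by auto
    have "inv h \<otimes> q \<otimes> h = inv (g \<otimes> h) \<otimes> a \<otimes> (g \<otimes> h)"
      using ball_closed[OF g] by (simp add: q m_assoc inv_mult_group)
    then show ?thesis
      unfolding conj_span_def by (auto intro!: generate.incl ball_mult g h)
  qed
  have S: "?S \<subseteq> carrier G"
    using ball_closed by auto
  have "p \<in> generate G ?S"
    using p by (simp add: conj_span_def)
  then show ?thesis
  proof induction
    case one
    then show ?case
      using subgroup.one_closed[OF conj_span_subgroup[OF a]] by simp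
  next
    case (incl q)
    then show ?case by (rule gen)
  next
    case (inv q)
    then have "inv h \<otimes> inv q \<otimes> h = inv (inv h \<otimes> q \<otimes> h)"
      using S by (auto simp: inv_mult_group m_assoc)
    then show ?case
      using gen[OF inv] by (simp add: conj_span_inv)
  next
    case (eng q r)
    have "q \<in> carrier G" "r \<in> carrier G"
      using eng S generate_in_carrier by auto
    then have "inv h \<otimes> (q \<otimes> r) \<otimes> h = (inv h \<otimes> q \<otimes> h) \<otimes> (inv h \<otimes> r \<otimes> h)"
      by (simp add: m_assoc)
    then show ?case
      using eng.IH by (simp add: conj_span_mult)
  qed
qed

text \<open>A commutator of \<open>p\<close> with \<open>h\<close> is \<open>p^-1\<close> times a
  conjugate of \<open>p\<close>, and the opposite commutator is its inverse. The cost is again the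
  length of \<open>h\<close> alone.\<close>

lemma conj_span_commutator:
  assumes "a \<in> carrier G" "h \<in> ball m" "p \<in> conj_span a n"
  shows "commutator G p h \<in> conj_span a (n + m)" "commutator G h p \<in> conj_span a (n + m)"
proof -
  have p: "p \<in> carrier G" "h \<in> carrier G"
    using conj_span_closed[OF assms(1,3)] ball_closed[OF assms(2)] .
  have "commutator G p h = inv p \<otimes> (inv h \<otimes> p \<otimes> h)"
    using p by (simp add: commutator_def m_assoc)
  moreover have "inv p \<in> conj_span a (n + m)"
    using conj_span_inv[OF assms(1,3)] conj_span_mono[of n "n + m" a] by auto
  ultimately show "commutator G p h \<in> conj_span a (n + m)"
    using conj_span_mult[OF assms(1) _ conj_span_conj[OF assms]] by simp
  then have "inv (commutator G p h) \<in> conj_span a (n + m)"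
    by (rule conj_span_inv[OF assms(1)])
  then show "commutator G h p \<in> conj_span a (n + m)"
    using p by (simp add: inv_commutator)
qed

end

text \<open>
  The classical argument that 2-Engel groups are nilpotent of class at most 3, with control on the
  lengths of the words to which the Engel condition is applied.
\<close>
locale local_two_Engel = symmetric_subset +
  assumes conj_commute: "a \<in> ball 32 \<Longrightarrow> g \<in> ball 32 \<Longrightarrow>
    (inv g \<otimes> a \<otimes> g) \<otimes> a = a \<otimes> (inv g \<otimes> a \<otimes> g)"
begin

text \<open>Local form of the fact that the normal closure of an element of a 2-Engel group is
  abelian. For conjugators \<open>g\<close> and \<open>h\<close> of length 16, \<open>g h^-1\<close>
  has length 32, so the conjugate of \<open>a\<close> by it commutes with \<open>a\<close>;
  conjugating by \<open>h\<close> makes the two generators commute.\<close>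

lemma conj_span_commute:
  assumes a: "a \<in> ball 32" and p: "p \<in> conj_span a 16" and q: "q \<in> conj_span a 16"
  shows "p \<otimes> q = q \<otimes> p"
proof -
  let ?S = "(\<lambda>g. inv g \<otimes> a \<otimes> g) ` ball 16"
  have [simp]: "a \<in> carrier G" using a ball_closed by blast
  have comm: "s \<otimes> t = t \<otimes> s" if "s \<in> ?S" "t \<in> ?S" for s t
  proof -
    from that obtain g h where g: "g \<in> ball 16" and h: "h \<in> ball 16"
      and s: "s = inv g \<otimes> a \<otimes> g" and t: "t = inv h \<otimes> a \<otimes> h"
      by auto
    note [simp] = ball_closed[OF g] ball_closed[OF h]
    let ?k = "g \<otimes> inv h"
    have "?k \<in> ball 32"
      using ball_mult[OF g ball_inv[OF h]] by simp
    then have "inv ?k \<otimes> a \<otimes> ?k \<otimes> a = a \<otimes> (inv ?k \<otimes> a \<otimes> ?k)"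
      using a by (rule conj_commute[rotated])
    then have "inv h \<otimes> (inv ?k \<otimes> a \<otimes> ?k \<otimes> a) \<otimes> h = inv h \<otimes> (a \<otimes> (inv ?k \<otimes> a \<otimes> ?k)) \<otimes> h"
      by simp
    then show ?thesis
      by (simp add: s t m_assoc inv_mult_group)
  qed
  have S: "?S \<subseteq> carrier G"
    using ball_closed by auto
  have "q \<otimes> s = s \<otimes> q" if "s \<in> ?S" for s
    using that S by (intro generate_commute[OF q[unfolded conj_span_def] S] comm) auto
  moreover have "q \<in> carrier G"
    using conj_span_closed[OF _ q] by simp
  ultimately show ?thesis
    by (intro generate_commute[OF p[unfolded conj_span_def] S]) simp_all
qed

lemma conj_span_commute_le:
  assumes "a \<in> ball 32" "p \<in> conj_span a m" "q \<in> conj_span a n" "m \<le> 16" "n \<le> 16"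
  shows "p \<otimes> q = q \<otimes> p"
  by (rule conj_span_commute[OF assms(1)])
    (use assms(2-) conj_span_mono[of m 16 a] conj_span_mono[of n 16 a] in auto)

section \<open>Commutators of weight two and three; entries of length 4 leave room for substituting
  commutators of elements of \<open>V\<close>\<close>

context
  fixes x y z
  assumes xyz: "x \<in> ball 4" "y \<in> ball 4" "z \<in> ball 4"
begin

lemma carrier_xyz [simp]: "x \<in> carrier G" "y \<in> carrier G" "z \<in> carrier G"
  using xyz ball_closed by auto

lemma commutator_mem_conj_span:
  "commutator G x y \<in> conj_span x 4" "commutator G x y \<in> conj_span y 4"
  using conj_span_commutator[of x y 4 x 0] conj_span_commutator[of y x 4 y 0] xyz
  by (auto simp: self_mem_conj_span)

text \<open>For \<open>z\<close> the conjugator is \<open>[x, y]\<close>, which has length 16; this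
  exhausts the range allowed by \<open>conj_span_commute\<close>.\<close>

lemma triple_mem_conj_span:
  "commutator G (commutator G x y) z \<in> conj_span x 8"
  "commutator G (commutator G x y) z \<in> conj_span y 8"
  "commutator G (commutator G x y) z \<in> conj_span z 16"
  using conj_span_commutator[of x z 4 "commutator G x y" 4]
    conj_span_commutator[of y z 4 "commutator G x y" 4]
    conj_span_commutator[of z "commutator G x y" 16 z 0]
    xyz commutator_mem_conj_span ball_commutator[of x 4 y 4]
  by (auto simp: self_mem_conj_span)

text \<open>\<open>[y, x]\<close> is the inverse of \<open>[x, y]\<close>, and the inverse can be
  pulled out because \<open>[[x, y], z]\<close> and \<open>[x, y]\<close> lie in the same abelian
  span of \<open>x\<close>.\<close>

lemma triple_swap_12:
  "commutator G (commutator G y x) z = inv (commutator G (commutator G x y) z)"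
proof -
  have "commutator G (commutator G x y) z \<otimes> commutator G x y
    = commutator G x y \<otimes> commutator G (commutator G x y) z"
    using triple_mem_conj_span(1) commutator_mem_conj_span(1) xyz(1) ball_mono[of 4 32]
    by (intro conj_span_commute_le[of x _ 8 _ 4]) auto
  then have "commutator G (inv (commutator G x y)) z = inv (commutator G (commutator G x y) z)"
    by (intro commutator_inv_left) auto
  then show ?thesis by (simp add: inv_commutator)
qed

end

lemma commutator_commute_snd:
  assumes "x \<in> ball 4" "y \<in> ball 4"
  shows "commutator G x y \<otimes> y = y \<otimes> commutator G x y"
  using commutator_mem_conj_span(2)[OF assms assms(2)] assms ball_mono[of 4 32] ball_closed[OF assms(2)]
  by (intro conj_span_commute_le[of y _ 4 _ 0]) (auto simp: self_mem_conj_span)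

lemma triple_commute_thd:
  assumes "x \<in> ball 4" "y \<in> ball 4" "z \<in> ball 4"
  shows "commutator G (commutator G x y) z \<otimes> z = z \<otimes> commutator G (commutator G x y) z"
  using assms ball_mono[of 4 32] triple_mem_conj_span(3)[OF assms] ball_closed[OF assms(3)]
  by (intro conj_span_commute_le[of z _ 16 _ 0]) (auto simp: self_mem_conj_span)

lemma triple_commute_snd:
  assumes "x \<in> ball 4" "y \<in> ball 4" "z \<in> ball 4"
  shows "commutator G (commutator G x y) z \<otimes> y = y \<otimes> commutator G (commutator G x y) z"
  using assms ball_mono[of 4 32] triple_mem_conj_span(2)[OF assms] ball_closed[OF assms(2)]
  by (intro conj_span_commute_le[of y _ 8 _ 0]) (auto simp: self_mem_conj_span)

lemma commutator_mult_right_triple: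
  assumes "x \<in> carrier G" "y \<in> carrier G" "z \<in> carrier G"
  shows "commutator G x (y \<otimes> z)
    = commutator G x z \<otimes> commutator G x y \<otimes> commutator G (commutator G x y) z"
  using assms by (simp add: commutator_mult_right conj_eq_mult_commutator flip: m_assoc)

text \<open>Linearization of the Engel identity: \<open>[x, y z] = q p t\<close> commutes with
  \<open>y z\<close>. Conjugation by \<open>y z\<close> sends \<open>q\<close> to
  \<open>q s\<close>, \<open>p\<close> to \<open>p t\<close> and fixes \<open>t\<close>; comparing
  both sides leaves \<open>s t = 1\<close>.\<close>

lemma triple_swap_23:
  assumes xyz: "x \<in> ball 4" "y \<in> ball 4" "z \<in> ball 4"
  shows "commutator G (commutator G x z) y = inv (commutator G (commutator G x y) z)"
proof -
  note [simp] = carrier_xyz[OF xyz]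
  define p where "p = commutator G x y"
  define q where "q = commutator G x z"
  define s where "s = commutator G q y"
  define t where "t = commutator G p z"
  have [simp]: "p \<in> carrier G" "q \<in> carrier G" "s \<in> carrier G" "t \<in> carrier G"
    by (simp_all add: p_def q_def s_def t_def)
  have y32: "x \<in> ball 32" "y \<in> ball 32" "z \<in> ball 32"
    using xyz ball_mono[of 4 32] by auto
  have py: "p \<otimes> y = y \<otimes> p"
    unfolding p_def by (rule commutator_commute_snd[OF xyz(1,2)])
  have qz: "q \<otimes> z = z \<otimes> q"
    unfolding q_def by (rule commutator_commute_snd[OF xyz(1,3)])
  have st: "s \<otimes> z = z \<otimes> s" "t \<otimes> y = y \<otimes> t" "t \<otimes> z = z \<otimes> t"
    using triple_commute_thd[OF xyz] triple_commute_snd[OF xyz] triple_commute_snd[OF xyz(1,3,2)]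
    by (simp_all add: p_def q_def s_def t_def)
  have sp: "s \<otimes> p = p \<otimes> s"
    using y32 triple_mem_conj_span(1)[OF xyz(1,3,2)] commutator_mem_conj_span(1)[OF xyz]
    by (intro conj_span_commute_le[of x _ 8 _ 4]) (auto simp: p_def q_def s_def t_def)
  let ?c = "commutator G x (y \<otimes> z)"
  have "y \<otimes> z \<in> ball 8"
    using ball_mult[OF xyz(2,3)] by simp
  then have "y \<otimes> z \<in> ball 32"
    using ball_mono[of 8 32] by auto
  then have "?c \<otimes> (y \<otimes> z) = (y \<otimes> z) \<otimes> ?c"
    using xyz(1) conj_span_commutator(2)[of "y \<otimes> z" x 4 "y \<otimes> z" 0]
    by (intro conj_span_commute_le[of "y \<otimes> z" _ 4 _ 0]) (auto simp: self_mem_conj_span)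
  then have "inv (y \<otimes> z) \<otimes> ?c \<otimes> (y \<otimes> z) = ?c"
    by (intro conj_eq_self) auto
  moreover have c: "?c = q \<otimes> p \<otimes> t"
    by (simp add: commutator_mult_right_triple p_def q_def t_def)
  moreover have "inv (y \<otimes> z) \<otimes> (q \<otimes> p \<otimes> t) \<otimes> (y \<otimes> z)
    = (inv z \<otimes> (inv y \<otimes> q \<otimes> y) \<otimes> z) \<otimes> (inv z \<otimes> (inv y \<otimes> p \<otimes> y) \<otimes> z)
      \<otimes> (inv z \<otimes> (inv y \<otimes> t \<otimes> y) \<otimes> z)"
    by (simp add: m_assoc inv_mult_group)
  moreover have "inv z \<otimes> (inv y \<otimes> q \<otimes> y) \<otimes> z = q \<otimes> s"
    using conj_eq_self[OF _ _ commute_mult[OF _ _ _ qz st(1)]]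
    by (simp add: conj_eq_mult_commutator[of q y] flip: s_def)
  moreover have "inv z \<otimes> (inv y \<otimes> p \<otimes> y) \<otimes> z = p \<otimes> t"
    using conj_eq_self[OF _ _ py] by (simp add: conj_eq_mult_commutator[of p z] flip: t_def)
  moreover have "inv z \<otimes> (inv y \<otimes> t \<otimes> y) \<otimes> z = t"
    using conj_eq_self[OF _ _ st(2)] conj_eq_self[OF _ _ st(3)] by simp
  ultimately have "q \<otimes> s \<otimes> (p \<otimes> t) \<otimes> t = q \<otimes> p \<otimes> t"
    by simp
  moreover have "q \<otimes> s \<otimes> (p \<otimes> t) \<otimes> t = q \<otimes> (s \<otimes> p) \<otimes> t \<otimes> t"
    by (simp add: m_assoc)
  then have "q \<otimes> s \<otimes> (p \<otimes> t) \<otimes> t = (q \<otimes> p) \<otimes> ((s \<otimes> t) \<otimes> t)"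
    by (simp add: sp m_assoc)
  ultimately have "(q \<otimes> p) \<otimes> ((s \<otimes> t) \<otimes> t) = (q \<otimes> p) \<otimes> t"
    by simp
  then have "(s \<otimes> t) \<otimes> t = \<one> \<otimes> t"
    by simp
  then have "s \<otimes> t = \<one>"
    by (subst (asm) right_cancel) auto
  then show ?thesis
    by (simp add: inv_equality flip: p_def q_def s_def t_def)
qed

text \<open>A 3-cycle is a product of two transpositions, and the two inversions cancel.\<close>

lemma triple_cycle:
  assumes "x \<in> ball 4" "y \<in> ball 4" "z \<in> ball 4"
  shows "commutator G (commutator G y z) x = commutator G (commutator G x y) z"
  using triple_swap_12[OF assms] triple_swap_23[OF assms(2,1,3)] assms
  by (metis ball_closed commutator_closed inv_inv)

text \<open>Expand \<open>[x, y z]\<close> directly and also through \<open>y z = z y k\<close> with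
  \<open>k = [y, z]\<close>. As \<open>k\<close> commutes with \<open>p\<close>, \<open>q\<close>
  and \<open>t\<close>, this gives \<open>q p t = c p q t^-1\<close>. All these factors lie in the
  abelian span of \<open>x\<close>, so \<open>c = t^2\<close>.\<close>

lemma commutator_commutator_right:
  assumes xyz: "x \<in> ball 4" "y \<in> ball 4" "z \<in> ball 4"
  shows "commutator G x (commutator G y z)
    = commutator G (commutator G x y) z \<otimes> commutator G (commutator G x y) z"
proof -
  note [simp] = carrier_xyz[OF xyz]
  define k where "k = commutator G y z"
  define p where "p = commutator G x y"
  define q where "q = commutator G x z"
  define t where "t = commutator G p z"
  define c where "c = commutator G x k"
  have [simp]: "k \<in> carrier G" "p \<in> carrier G" "q \<in> carrier G" "t \<in> carrier G" "c \<in> carrier G"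
    by (simp_all add: k_def p_def q_def t_def c_def)
  have s: "commutator G q y = inv t"
    using triple_swap_23[OF xyz] by (simp add: p_def q_def t_def)
  have x32: "x \<in> ball 32" "y \<in> ball 32" "z \<in> ball 32"
    using xyz ball_mono[of 4 32] by auto
  have kp: "p \<otimes> k = k \<otimes> p"
    using x32 commutator_mem_conj_span(2)[OF xyz] commutator_mem_conj_span(1)[OF xyz(2,3,1)]
    by (intro conj_span_commute_le[of y _ 4 _ 4]) (auto simp: p_def k_def)
  have kq: "q \<otimes> k = k \<otimes> q"
    using x32 commutator_mem_conj_span(2)[OF xyz(1,3,2)] commutator_mem_conj_span(2)[OF xyz(2,3,1)]
    by (intro conj_span_commute_le[of z _ 4 _ 4]) (auto simp: q_def k_def)
  have kt: "t \<otimes> k = k \<otimes> t"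
    using x32 triple_mem_conj_span(2)[OF xyz] commutator_mem_conj_span(1)[OF xyz(2,3,1)]
    by (intro conj_span_commute_le[of y _ 8 _ 4]) (auto simp: p_def t_def k_def)
  have "k \<in> ball 16"
    using ball_commutator[OF xyz(2,3)] by (simp add: k_def)
  then have cx: "c \<in> conj_span x 16"
    using conj_span_commutator(1)[of x k 16 x 0] by (simp add: c_def self_mem_conj_span)
  have px: "p \<in> conj_span x 16" "q \<in> conj_span x 16" "t \<in> conj_span x 16"
    using commutator_mem_conj_span(1)[OF xyz] commutator_mem_conj_span(1)[OF xyz(1,3,2)]
      triple_mem_conj_span(1)[OF xyz] conj_span_mono[of 4 16 x] conj_span_mono[of 8 16 x]
    by (auto simp: p_def q_def t_def)
  note comm = conj_span_commute[OF x32(1)]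
  have "y \<otimes> z = z \<otimes> y \<otimes> k"
    by (simp add: k_def commutator_def m_assoc)
  then have "commutator G x (y \<otimes> z) = c \<otimes> (inv k \<otimes> commutator G x (z \<otimes> y) \<otimes> k)"
    by (simp add: commutator_mult_right[of x "z \<otimes> y" k] c_def)
  also have "commutator G x (z \<otimes> y) = p \<otimes> q \<otimes> inv t"
    by (simp add: commutator_mult_right_triple s flip: p_def q_def)
  also have "inv k \<otimes> (p \<otimes> q \<otimes> inv t) \<otimes> k = p \<otimes> q \<otimes> inv t"
    using commute_mult[OF _ _ _ commute_mult[OF _ _ _ kp kq] commute_inv[OF _ _ kt]]
    by (intro conj_eq_self) auto
  finally have "q \<otimes> p \<otimes> t = c \<otimes> (p \<otimes> q \<otimes> inv t)"
    by (simp add: commutator_mult_right_triple flip: p_def q_def t_def)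
  also have "\<dots> = (p \<otimes> q) \<otimes> (c \<otimes> inv t)"
    using comm[OF cx conj_span_mult[OF _ px(1,2)]] by (simp flip: m_assoc)
  also have "p \<otimes> q = q \<otimes> p"
    by (rule comm[OF px(1,2)])
  finally have "t = c \<otimes> inv t"
    by (simp add: m_assoc)
  then have "t \<otimes> t = c \<otimes> inv t \<otimes> t"
    by simp
  then show ?thesis
    by (simp add: m_assoc c_def flip: p_def q_def t_def k_def)
qed

text \<open>\<open>t^2\<close> is \<open>[x, [y, z]]\<close>, the inverse of
  \<open>[[y, z], x]\<close>, which equals \<open>t\<close> by cyclic symmetry.\<close>

lemma triple_cube:
  assumes "x \<in> ball 4" "y \<in> ball 4" "z \<in> ball 4"
  defines "t \<equiv> commutator G (commutator G x y) z"
  shows "t \<otimes> t \<otimes> t = \<one>"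
proof -
  note [simp] = carrier_xyz[OF assms(1-3)]
  have "t \<otimes> t = inv (commutator G (commutator G y z) x)"
    using commutator_commutator_right[OF assms(1-3)] by (simp add: t_def inv_commutator)
  also have "\<dots> = inv t"
    using triple_cycle[OF assms(1-3)] by (simp add: t_def)
  finally show ?thesis by (simp add: t_def)
qed

text \<open>Evaluating \<open>[[x, y], [z, t]]\<close> as it stands gives \<open>q^2\<close>, and
  exchanging the two pairs gives the inverse of \<open>q^2\<close>. So \<open>q^4 = 1\<close>, while
  \<open>q^3 = 1\<close> by \<open>triple_cube\<close>.\<close>

lemma quadruple_commutator_eq_one:
  assumes V: "x \<in> V" "y \<in> V" "z \<in> V" "t \<in> V"
  shows "commutator G (commutator G (commutator G x y) z) t = \<one>"
proof -
  have b1: "x \<in> ball 1" "y \<in> ball 1" "z \<in> ball 1" "t \<in> ball 1"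
    using V mem_ball_one by auto
  then have b4: "x \<in> ball 4" "y \<in> ball 4" "z \<in> ball 4" "t \<in> ball 4"
    using ball_mono[of 1 4] by auto
  have x32: "x \<in> ball 32"
    using b4 ball_mono[of 4 32] by auto
  note [simp] = b4[THEN ball_closed]
  have w: "commutator G a b \<in> ball 4" if "a \<in> {x, y, z, t}" "b \<in> {x, y, z, t}" for a b
  proof -
    have "a \<in> ball 1" "b \<in> ball 1"
      using b1 that by auto
    then show ?thesis
      using ball_commutator[of a 1 b 1] by (simp add: eval_nat_numeral)
  qed
  define T where "T = commutator G (commutator G x y) z"
  define q where "q = commutator G T t"
  have [simp]: "T \<in> carrier G" "q \<in> carrier G"
    by (simp_all add: T_def q_def)
  have T: "T \<in> conj_span x 8"
    using triple_mem_conj_span(1)[OF b4(1-3)] by (simp add: T_def)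
  then have "q \<in> conj_span x 12"
    using conj_span_commutator(1)[OF _ b4(4) T] by (simp add: q_def)
  then have qT: "q \<otimes> T = T \<otimes> q"
    using x32 T by (intro conj_span_commute_le[of x _ 12 _ 8]) auto
  \<comment> \<open>The weight-four commutator arising from the exchanged pairs is again
    \<open>q\<close>: one cyclic shift, then two transpositions whose inversions cancel.\<close>
  have "commutator G (commutator G (commutator G z t) x) y
    = commutator G (commutator G (commutator G x z) t) y"
    by (subst triple_cycle[of x z t]) (use b4 in auto)
  also have "\<dots> = inv (commutator G (commutator G (commutator G x z) y) t)"
    by (rule triple_swap_23) (use b4 w in auto)
  also have "commutator G (commutator G x z) y = inv T"
    using triple_swap_23[OF b4(1-3)] by (simp add: T_def)
  also have "commutator G (inv T) t = inv q"
    unfolding q_def by (rule commutator_inv_left) (use qT in \<open>auto simp: q_def\<close>)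
  finally have r: "commutator G (commutator G (commutator G z t) x) y = q"
    by simp
  have "q \<otimes> q = commutator G (commutator G x y) (commutator G z t)"
    using commutator_commutator_right[of "commutator G x y" z t] b4 w
    by (simp add: q_def T_def)
  also have "\<dots> = inv (commutator G (commutator G z t) (commutator G x y))"
    by (simp add: inv_commutator)
  also have "\<dots> = inv (q \<otimes> q)"
    using commutator_commutator_right[of "commutator G z t" x y] b4 w r by simp
  finally have "(q \<otimes> q \<otimes> q) \<otimes> q = \<one>"
    by (metis \<open>q \<in> carrier G\<close> m_assoc m_closed r_inv)
  moreover have "q \<otimes> q \<otimes> q = \<one>"
    using triple_cube[of "commutator G x y" z t] b4 w by (simp add: q_def T_def)
  ultimately have "q = \<one>"
    by simp
  then show ?thesis
    by (simp add: q_def T_def)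
qed

end

subsection \<open>From generators to the group\<close>

text \<open>For normal \<open>N\<close> this is the preimage of the center of \<open>G/N\<close>;
  iterated from the trivial subgroup it yields the upper central series.\<close>

definition central_step :: "('a, 'b) monoid_scheme \<Rightarrow> 'a set \<Rightarrow> 'a set" where
  "central_step G N = {p \<in> carrier G. \<forall>c\<in>carrier G. commutator G p c \<in> N}"

context group
begin

lemma normal_central_step:
  assumes N: "N \<lhd> G"
  shows "central_step G N \<lhd> G"
proof -
  interpret N: subgroup N G
    using N by (rule normal_imp_subgroup)
  show ?thesis
    unfolding normal_inv_iff
  proof (intro conjI ballI subgroupI)
    show "central_step G N \<subseteq> carrier G"
      by (auto simp: central_step_def)
    show "central_step G N \<noteq> {}"
      using N.one_closed by (auto simp: central_step_def commutator_def intro!: exI[of _ \<one>])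
  next
    fix p assume p: "p \<in> central_step G N"
    have "commutator G (inv p) c \<in> N" if c: "c \<in> carrier G" for c
    proof -
      have "commutator G (inv p) c = p \<otimes> inv (commutator G p c) \<otimes> inv p"
        using p c by (simp add: central_step_def commutator_def inv_mult_group m_assoc)
      then show ?thesis
        using p c normal.inv_op_closed2[OF N, of p "inv (commutator G p c)"]
        by (simp add: central_step_def)
    qed
    then show "inv p \<in> central_step G N"
      using p by (simp add: central_step_def)
  next
    fix p q assume "p \<in> central_step G N" "q \<in> central_step G N"
    then show "p \<otimes> q \<in> central_step G N"
      using normal.inv_op_closed1[OF N] by (simp add: central_step_def commutator_mult_left)
  next
    fix h p assume h: "h \<in> carrier G" and p: "p \<in> central_step G N"
    have "commutator G (h \<otimes> p \<otimes> inv h) c \<in> N" if c: "c \<in> carrier G" for c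
    proof -
      have "commutator G (h \<otimes> p \<otimes> inv h) c = h \<otimes> commutator G p (inv h \<otimes> c \<otimes> h) \<otimes> inv h"
        using p c h by (simp add: central_step_def commutator_def inv_mult_group m_assoc)
      then show ?thesis
        using p c h normal.inv_op_closed2[OF N] by (simp add: central_step_def)
    qed
    then show "h \<otimes> p \<otimes> inv h \<in> central_step G N"
      using p h by (simp add: central_step_def)
  qed
qed

text \<open>The elements that commute with \<open>p\<close> modulo \<open>N\<close> form a subgroup,
  so generators suffice.\<close>

lemma mem_central_stepI:
  assumes N: "N \<lhd> G" and V: "V \<subseteq> carrier G" "generate G V = carrier G" and p: "p \<in> carrier G"
    and gen: "\<And>v. v \<in> V \<Longrightarrow> commutator G p v \<in> N"
  shows "p \<in> central_step G N"
proof -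
  interpret N: subgroup N G
    using N by (rule normal_imp_subgroup)
  let ?S = "{c \<in> carrier G. commutator G p c \<in> N}"
  have "subgroup ?S G"
  proof (rule subgroupI)
    have "commutator G p \<one> = \<one>"
      using p by (simp add: commutator_def)
    then show "?S \<noteq> {}"
      by (auto intro!: exI[of _ \<one>])
  next
    fix c assume c: "c \<in> ?S"
    then have "commutator G p (inv c) = c \<otimes> inv (commutator G p c) \<otimes> inv c"
      using p by (simp add: commutator_def inv_mult_group m_assoc)
    then show "inv c \<in> ?S"
      using c normal.inv_op_closed2[OF N, of c "inv (commutator G p c)"] by simp
  next
    fix c d assume "c \<in> ?S" "d \<in> ?S"
    then show "c \<otimes> d \<in> ?S"
      using p normal.inv_op_closed1[OF N] by (simp add: commutator_mult_right)
  qed auto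
  moreover have "V \<subseteq> ?S"
    using V gen by auto
  ultimately have "carrier G \<subseteq> ?S"
    using generate_subgroup_incl V(2) by metis
  then show ?thesis
    using p by (auto simp: central_step_def)
qed

text \<open>The variables are freed from the last to the first: each passage from generators to the
  group climbs one term of the upper central series, until \<open>V\<close>, and hence
  \<open>G\<close>, lies in the third.\<close>

lemma quadruple_commutator_eq_one_if_generators:
  assumes V: "V \<subseteq> carrier G" "generate G V = carrier G"
    and gen: "\<And>x y z t. x \<in> V \<Longrightarrow> y \<in> V \<Longrightarrow> z \<in> V \<Longrightarrow> t \<in> V \<Longrightarrow>
      commutator G (commutator G (commutator G x y) z) t = \<one>"
    and "a \<in> carrier G" "b \<in> carrier G" "c \<in> carrier G" "d \<in> carrier G"
  shows "commutator G (commutator G (commutator G a b) c) d = \<one>"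
proof -
  define Z1 where "Z1 = central_step G {\<one>}"
  define Z2 where "Z2 = central_step G Z1"
  define Z3 where "Z3 = central_step G Z2"
  have N: "{\<one>} \<lhd> G" "Z1 \<lhd> G" "Z2 \<lhd> G" "Z3 \<lhd> G"
    by (simp_all add: Z1_def Z2_def Z3_def one_is_normal normal_central_step)
  note I = mem_central_stepI[OF _ V]
  have v: "v \<in> carrier G" if "v \<in> V" for v
    using that V by auto
  have "commutator G (commutator G x y) z \<in> Z1" if "x \<in> V" "y \<in> V" "z \<in> V" for x y z
    unfolding Z1_def using that gen v by (intro I[OF N(1)]) auto
  then have "commutator G x y \<in> Z2" if "x \<in> V" "y \<in> V" for x y
    unfolding Z2_def using that v by (intro I[OF N(2)]) auto
  then have "x \<in> Z3" if "x \<in> V" for x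
    unfolding Z3_def using that v by (intro I[OF N(3)]) auto
  then have "carrier G \<subseteq> Z3"
    using generate_subgroup_incl[OF _ normal_imp_subgroup[OF N(4)]] V(2) by blast
  then show ?thesis
    using assms(4-) by (auto simp: Z1_def Z2_def Z3_def central_step_def)
qed

text \<open>The kernel of \<open>f\<close> is a subgroup containing \<open>V\<close>. This serves to
  extend identities one variable at a time.\<close>

lemma multiplicative_trivial:
  assumes V: "V \<subseteq> carrier G" "generate G V = carrier G"
    and closed: "\<And>x. x \<in> carrier G \<Longrightarrow> f x \<in> carrier G"
    and mult: "\<And>x y. x \<in> carrier G \<Longrightarrow> y \<in> carrier G \<Longrightarrow> f (x \<otimes> y) = f x \<otimes> f y"
    and gen: "\<And>v. v \<in> V \<Longrightarrow> f v = \<one>"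
    and x: "x \<in> carrier G"
  shows "f x = \<one>"
proof -
  have hom: "f \<in> hom G G"
    using closed mult by (auto simp: hom_def)
  interpret group_hom G G f
    by unfold_locales (rule hom)
  have "generate G V \<subseteq> kernel G G f"
    using V gen by (intro generate_subgroup_incl subgroup_kernel) (auto simp: kernel_def)
  then show ?thesis
    using x V(2) by (auto simp: kernel_def)
qed

text \<open>
  In a group of class 3, \<open>[[a, b], c]\<close> is multiplicative in each variable, so that the Engel
  identity, which says that this map is alternating in \<open>b\<close> and \<open>c\<close>, passes from generators to the group.
\<close>
lemma two_Engel_if_generators:
  assumes V: "V \<subseteq> carrier G" "generate G V = carrier G"
    and quad: "\<And>x y z t. x \<in> V \<Longrightarrow> y \<in> V \<Longrightarrow> z \<in> V \<Longrightarrow> t \<in> V \<Longrightarrow>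
      commutator G (commutator G (commutator G x y) z) t = \<one>"
    and swap: "\<And>x y z. x \<in> V \<Longrightarrow> y \<in> V \<Longrightarrow> z \<in> V \<Longrightarrow>
      commutator G (commutator G x z) y = inv (commutator G (commutator G x y) z)"
    and engel: "\<And>x y. x \<in> V \<Longrightarrow> y \<in> V \<Longrightarrow> commutator G (commutator G x y) y = \<one>"
  shows "two_Engel G"
proof -
  define T where "T a b c = commutator G (commutator G a b) c" for a b c
  have T_closed [simp, intro]: "T a b c \<in> carrier G"
    if "a \<in> carrier G" "b \<in> carrier G" "c \<in> carrier G" for a b c
    using that by (simp add: T_def)
  have T_one: "commutator G (T a b c) d = \<one>"
    if "a \<in> carrier G" "b \<in> carrier G" "c \<in> carrier G" "d \<in> carrier G" for a b c d
    using quadruple_commutator_eq_one_if_generators[OF V quad that] by (simp add: T_def)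
  have T_central: "T a b c \<otimes> d = d \<otimes> T a b c"
    if "a \<in> carrier G" "b \<in> carrier G" "c \<in> carrier G" "d \<in> carrier G" for a b c d
    using T_one[OF that] that by (subst (asm) commutator_eq_one_iff) auto
  have T_conj: "inv d \<otimes> T a b c \<otimes> d = T a b c"
    if "a \<in> carrier G" "b \<in> carrier G" "c \<in> carrier G" "d \<in> carrier G" for a b c d
    using that T_central by (intro conj_eq_self) auto
  have T3: "T a b (c \<otimes> c') = T a b c \<otimes> T a b c'"
    if [simp]: "a \<in> carrier G" "b \<in> carrier G" "c \<in> carrier G" "c' \<in> carrier G" for a b c c'
    using commutator_mult_right[of "commutator G a b" c c'] T_conj[of a b c c'] T_central[of a b c "T a b c'"]
    by (simp flip: T_def)
  have T_mult: "commutator G (commutator G a b \<otimes> p) d = T a b d \<otimes> commutator G p d"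
    if [simp]: "a \<in> carrier G" "b \<in> carrier G" "d \<in> carrier G" "p \<in> carrier G" for a b p d
    using commutator_mult_left[of "commutator G a b" p d] T_conj[of a b d p] by (simp flip: T_def)
  \<comment> \<open>Central factors inside a commutator drop out, which removes the correction terms
    in \<open>T1\<close> and \<open>T2\<close>.\<close>
  have T_mult': "commutator G (T a b c \<otimes> p) d = commutator G p d"
    if [simp]: "a \<in> carrier G" "b \<in> carrier G" "c \<in> carrier G" "d \<in> carrier G" "p \<in> carrier G" for a b c p d
    using commutator_mult_left[of "T a b c" p d] T_one[of a b c d] by simp
  have T2: "T a (b \<otimes> b') c = T a b c \<otimes> T a b' c"
    if [simp]: "a \<in> carrier G" "b \<in> carrier G" "b' \<in> carrier G" "c \<in> carrier G" for a b b' c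
  proof -
    have "commutator G a (b \<otimes> b') = commutator G a b' \<otimes> (commutator G a b \<otimes> T a b b')"
      by (simp add: commutator_mult_right conj_eq_mult_commutator T_def)
    also have "\<dots> = commutator G a b' \<otimes> (T a b b' \<otimes> commutator G a b)"
      by (simp add: T_central)
    finally show ?thesis
      using T_central[of a b c "T a b' c"] by (simp add: T_def[of a "b \<otimes> b'"] T_mult T_mult' flip: T_def[of a b c])
  qed
  have T1: "T (a \<otimes> a') b c = T a b c \<otimes> T a' b c"
    if [simp]: "a \<in> carrier G" "a' \<in> carrier G" "b \<in> carrier G" "c \<in> carrier G" for a a' b c
  proof -
    have "commutator G (a \<otimes> a') b = commutator G a b \<otimes> (T a b a' \<otimes> commutator G a' b)"
      by (simp add: commutator_mult_left conj_eq_mult_commutator T_def flip: m_assoc)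
    then show ?thesis
      by (simp add: T_def[of "a \<otimes> a'"] T_mult T_mult' flip: T_def[of a' b c])
  qed
  \<comment> \<open>\<open>g\<close> measures the failure of antisymmetry in the last two variables.
    Since the values of \<open>T\<close> are central, \<open>g\<close> is multiplicative in each
    variable.\<close>
  define g where "g a b c = T a b c \<otimes> T a c b" for a b c
  have g_closed [simp, intro]: "g a b c \<in> carrier G"
    if "a \<in> carrier G" "b \<in> carrier G" "c \<in> carrier G" for a b c
    using that by (simp add: g_def)
  have middle: "(p \<otimes> q) \<otimes> (r \<otimes> s) = (p \<otimes> r) \<otimes> (q \<otimes> s)"
    if "q \<otimes> r = r \<otimes> q" "p \<in> carrier G" "q \<in> carrier G" "r \<in> carrier G" "s \<in> carrier G" for p q r s
    using that by (metis m_assoc m_closed)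
  have v: "v \<in> carrier G" if "v \<in> V" for v
    using that V by auto
  note trivial = multiplicative_trivial[OF V]
  have g_V: "g a b c = \<one>" if "a \<in> V" "b \<in> V" "c \<in> V" for a b c
    using that v swap[of a b c] by (simp add: g_def T_def)
  have g1: "g a b c = \<one>" if "a \<in> carrier G" "b \<in> V" "c \<in> V" for a b c
    by (rule trivial[where f = "\<lambda>a. g a b c"])
      (use that v g_V in \<open>auto simp: g_def T1 intro!: middle T_central\<close>)
  have g2: "g a b c = \<one>" if "a \<in> carrier G" "b \<in> carrier G" "c \<in> V" for a b c
    by (rule trivial[where f = "\<lambda>b. g a b c"])
      (use that v g1 in \<open>auto simp: g_def T2 T3 intro!: middle T_central\<close>)
  have g3: "g a b c = \<one>" if "a \<in> carrier G" "b \<in> carrier G" "c \<in> carrier G" for a b c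
    by (rule trivial[where f = "\<lambda>c. g a b c"])
      (use that v g2 in \<open>auto simp: g_def T2 T3 intro!: middle T_central\<close>)
  have e1: "T a b b = \<one>" if "a \<in> carrier G" "b \<in> V" for a b
    by (rule trivial[where f = "\<lambda>a. T a b b"]) (use that v engel[folded T_def] in \<open>auto simp: T1\<close>)
  have "T a b b = \<one>" if a: "a \<in> carrier G" and b: "b \<in> carrier G" for a b
  proof (rule trivial[where f = "\<lambda>b. T a b b"])
    fix x y assume [simp]: "x \<in> carrier G" "y \<in> carrier G"
    note [simp] = a
    \<comment> \<open>The cross terms of this expansion form \<open>g a y x = \<one>\<close>, so the
      diagonal map is multiplicative even though it is quadratic in form.\<close>
    have "T a (x \<otimes> y) (x \<otimes> y) = (T a x x \<otimes> T a y x) \<otimes> (T a x y \<otimes> T a y y)"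
      by (simp add: T2 T3)
    also have "\<dots> = T a x x \<otimes> g a y x \<otimes> T a y y"
      by (simp add: g_def m_assoc)
    finally show "T a (x \<otimes> y) (x \<otimes> y) = T a x x \<otimes> T a y y"
      by (simp add: g3)
  qed (use a b e1 in auto)
  then show ?thesis
    by (simp add: two_Engel_def T_def is_group)
qed

end

subsection \<open>Neighbourhoods of the identity and Haar measure\<close>

lemma word_ball_mono: "V \<subseteq> V' \<Longrightarrow> word_ball G V n \<subseteq> word_ball G V' n"
  by (induction n) (auto simp: word_ball.simps)

context topological_group
begin

lemma continuous_map_mult [continuous_intros]:
  assumes "continuous_map X T f" "continuous_map X T g"
  shows "continuous_map X T (\<lambda>x. f x \<otimes> g x)"
  using continuous_map_compose[OF continuous_map_pairedI[OF assms] continuous_mult]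
  by (simp add: o_def)

lemma continuous_map_inv [continuous_intros]:
  "continuous_map X T f \<Longrightarrow> continuous_map X T (\<lambda>x. inv f x)"
  using continuous_map_compose[OF _ continuous_inv] by (simp add: o_def)

lemma continuous_map_const_carrier: "g \<in> carrier G \<Longrightarrow> continuous_map X T (\<lambda>_. g)"
  by (simp add: topspace_eq_carrier)

lemma continuous_map_left_translate: "g \<in> carrier G \<Longrightarrow> continuous_map T T (\<lambda>x. g \<otimes> x)"
  by (intro continuous_map_mult continuous_map_const_carrier) (simp_all flip: id_def)

lemma l_coset_eq_vimage:
  assumes "g \<in> carrier G" "A \<subseteq> carrier G"
  shows "l_coset G g A = {x \<in> topspace T. inv g \<otimes> x \<in> A}"
proof (intro equalityI subsetI)
  fix x assume "x \<in> {x \<in> topspace T. inv g \<otimes> x \<in> A}"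
  then show "x \<in> l_coset G g A"
    using assms by (auto simp: l_coset_def topspace_eq_carrier intro!: bexI[of _ "inv g \<otimes> x"])
qed (use assms in \<open>auto simp: l_coset_def topspace_eq_carrier\<close>)

lemma openin_l_coset:
  assumes "g \<in> carrier G" "openin T U"
  shows "openin T (l_coset G g U)"
proof -
  have "U \<subseteq> carrier G"
    using openin_subset[OF assms(2)] topspace_eq_carrier by simp
  then show ?thesis
    using assms openin_continuous_map_preimage[OF continuous_map_left_translate assms(2)]
    by (simp add: l_coset_eq_vimage)
qed

text \<open>The subgroup is a union of open translates of \<open>U\<close>.\<close>

lemma openin_subgroup_if_nbhd:
  assumes H: "subgroup H G" and U: "openin T U" "\<one> \<in> U" "U \<subseteq> H"
  shows "openin T H"
proof (subst openin_subopen, intro ballI exI conjI)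
  fix h assume h: "h \<in> H"
  show "openin T (l_coset G h U)"
    using h H U subgroup.mem_carrier openin_l_coset by metis
  show "h \<in> l_coset G h U"
    using h H U by (auto simp: l_coset_def subgroup.mem_carrier intro!: bexI[of _ \<one>])
  show "l_coset G h U \<subseteq> H"
    using h H U by (auto simp: l_coset_def subgroup.m_closed)
qed

text \<open>The tube lemma, applied to the compact set \<open>{\<one>} \<times> K\<close> inside the
  preimage of \<open>W\<close>.\<close>

lemma nbhd_one_tube:
  assumes f: "continuous_map (prod_topology T T) T (\<lambda>(u, k). f u k)"
    and K: "compactin T K" and W: "openin T W" "\<And>k. k \<in> K \<Longrightarrow> f \<one> k \<in> W"
  shows "\<exists>U. openin T U \<and> \<one> \<in> U \<and> (\<forall>u\<in>U. \<forall>k\<in>K. f u k \<in> W)"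
proof -
  let ?W = "{p \<in> topspace (prod_topology T T). (case p of (u, k) \<Rightarrow> f u k) \<in> W}"
  have "K \<subseteq> topspace T"
    using K by (rule compactin_subset_topspace)
  then have sub: "{\<one>} \<times> K \<subseteq> ?W"
    using W by (auto simp: topspace_eq_carrier)
  have op: "openin (prod_topology T T) ?W"
    by (rule openin_continuous_map_preimage[OF f W(1)])
  have "compactin T {\<one>}"
    by (simp add: topspace_eq_carrier)
  then obtain U V where UV: "openin T U" "{\<one>} \<subseteq> U" "K \<subseteq> V" "U \<times> V \<subseteq> ?W"
    by (rule Wallace_theorem_prod_topology[OF _ K op sub])
  have "f u k \<in> W" if "u \<in> U" "k \<in> K" for u k
  proof -
    have "(u, k) \<in> ?W"
      using that UV(3,4) by blast
    then show ?thesis by simp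
  qed
  then show ?thesis
    using UV(1,2) by (intro exI[of _ U]) simp
qed

lemma nbhd_one_mult:
  assumes W: "openin T W" "\<one> \<in> W"
  shows "\<exists>U V. openin T U \<and> openin T V \<and> \<one> \<in> U \<and> \<one> \<in> V \<and> (\<forall>u\<in>U. \<forall>v\<in>V. u \<otimes> v \<in> W)"
proof -
  let ?W = "{p \<in> topspace (prod_topology T T). (case p of (u, k) \<Rightarrow> u \<otimes> k) \<in> W}"
  have op: "openin (prod_topology T T) ?W"
    by (rule openin_continuous_map_preimage[OF continuous_mult W(1)])
  have "(\<one>, \<one>) \<in> ?W"
    using W by (simp add: topspace_eq_carrier)
  from openin_prod_topology_alt[THEN iffD1, rule_format, OF op this]
  obtain U V where UV: "openin T U" "openin T V" "\<one> \<in> U" "\<one> \<in> V" "U \<times> V \<subseteq> ?W"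
    by (elim exE conjE)
  have "u \<otimes> v \<in> W" if "u \<in> U" "v \<in> V" for u v
  proof -
    have "(u, v) \<in> ?W"
      using that UV(5) by blast
    then show ?thesis by simp
  qed
  then show ?thesis
    using UV(1-4) by (intro exI[of _ U] exI[of _ V]) simp
qed

lemma nbhd_one_word_ball:
  assumes "openin T W" "\<one> \<in> W"
  shows "\<exists>V. openin T V \<and> \<one> \<in> V \<and> word_ball G V n \<subseteq> W"
  using assms
proof (induction n arbitrary: W)
  case 0
  then show ?case
    using openin_topspace[of T] by (intro exI[of _ "carrier G"]) (simp add: topspace_eq_carrier)
next
  case (Suc n)
  obtain U1 U2 where U: "openin T U1" "openin T U2" "\<one> \<in> U1" "\<one> \<in> U2"
    "\<forall>u\<in>U1. \<forall>v\<in>U2. u \<otimes> v \<in> W"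
    using nbhd_one_mult[OF Suc.prems] by blast
  obtain V where V: "openin T V" "\<one> \<in> V" "word_ball G V n \<subseteq> U1"
    using Suc.IH[OF U(1,3)] by blast
  have "word_ball G (V \<inter> U2) n \<subseteq> U1"
    using V(3) word_ball_mono[of "V \<inter> U2" V G n] by blast
  then have "word_ball G (V \<inter> U2) (Suc n) \<subseteq> W"
    using U(5) by (auto simp: word_ball.simps)
  then show ?case
    using U V by (intro exI[of _ "V \<inter> U2"]) auto
qed

text \<open>\<open>V\<close> is the largest symmetric conjugation-invariant subset of
  \<open>W\<close>. Conjugation sends \<open>{\<one>} \<times> G\<close> to \<open>\<one>\<close>,
  so compactness and the tube lemma place an open neighbourhood inside \<open>V\<close>; openness of
  \<open>V\<close> itself is not asserted.\<close>

lemma nbhd_one_invariant: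
  assumes T: "compact_space T" and W: "openin T W" "\<one> \<in> W"
  defines "V \<equiv> {v \<in> carrier G. \<forall>g\<in>carrier G. g \<otimes> v \<otimes> inv g \<in> W \<and> inv (g \<otimes> v \<otimes> inv g) \<in> W}"
  shows "V \<subseteq> W" "symmetric_subset G V" "\<And>g v. g \<in> carrier G \<Longrightarrow> v \<in> V \<Longrightarrow> g \<otimes> v \<otimes> inv g \<in> V"
    "\<exists>U. openin T U \<and> \<one> \<in> U \<and> U \<subseteq> V"
proof -
  show "V \<subseteq> W"
  proof
    fix v assume "v \<in> V"
    then have "\<one> \<otimes> v \<otimes> inv \<one> \<in> W" "v \<in> carrier G"
      unfolding V_def by blast+
    then show "v \<in> W" by simp
  qed
  have inv_conj: "inv (g \<otimes> v \<otimes> inv g) = g \<otimes> inv v \<otimes> inv g" if "g \<in> carrier G" "v \<in> carrier G" for g v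
    using that by (simp add: inv_mult_group m_assoc)
  show "symmetric_subset G V"
    by unfold_locales (use W in \<open>auto simp: V_def inv_conj\<close>)
  show "g \<otimes> v \<otimes> inv g \<in> V" if g: "g \<in> carrier G" and v: "v \<in> V" for g v
  proof -
    have vG: "v \<in> carrier G" using v by (simp add: V_def)
    have "h \<otimes> (g \<otimes> v \<otimes> inv g) \<otimes> inv h = (h \<otimes> g) \<otimes> v \<otimes> inv (h \<otimes> g)" if "h \<in> carrier G" for h
      using that g vG by (simp add: inv_mult_group m_assoc)
    then show ?thesis
      using g v unfolding V_def by auto
  qed
  let ?W = "W \<inter> {x \<in> topspace T. inv x \<in> W}"
  have op: "openin T ?W"
    using W openin_continuous_map_preimage[OF continuous_inv W(1)] by (intro openin_Int)
  have cont: "continuous_map (prod_topology T T) T (\<lambda>(u, k). k \<otimes> u \<otimes> inv k)"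
    unfolding case_prod_beta by (intro continuous_intros)
  have comp: "compactin T (carrier G)"
    using T by (simp add: compact_space_def topspace_eq_carrier)
  have "k \<otimes> \<one> \<otimes> inv k \<in> ?W" if "k \<in> carrier G" for k
    using that W by (simp add: topspace_eq_carrier)
  then obtain U where U: "openin T U" "\<one> \<in> U" "\<forall>u\<in>U. \<forall>k\<in>carrier G. k \<otimes> u \<otimes> inv k \<in> ?W"
    using nbhd_one_tube[of "\<lambda>u k. k \<otimes> u \<otimes> inv k", OF cont comp op] by blast
  then have "U \<subseteq> V"
    using openin_subset[OF U(1)] topspace_eq_carrier by (auto simp: V_def)
  with U show "\<exists>U. openin T U \<and> \<one> \<in> U \<and> U \<subseteq> V" by blast
qed

lemma commutator_restrict:
  assumes "subgroup H G" "a \<in> H" "b \<in> H"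
  shows "commutator (G\<lparr>carrier := H\<rparr>) a b = commutator G a b"
  using assms by (simp add: commutator_def m_inv_consistent)

end

context normalized_haar_measure
begin

section \<open>Translates of a closed set of positive Haar measure\<close>

lemma openin_sets: "openin T U \<Longrightarrow> U \<in> sets M"
  using sets_eq_borel by (auto intro: sigma_sets.Basic)

lemma closedin_sets:
  assumes "closedin T C"
  shows "C \<in> sets M"
proof -
  have "space M - (topspace T - C) \<in> sets M"
    using assms by (intro sets.compl_sets openin_sets) (simp add: closedin_def)
  moreover have "space M - (topspace T - C) = C"
    using closedin_subset[OF assms] by (auto simp: space_eq_carrier topspace_eq_carrier)
  ultimately show ?thesis by simp
qed

text \<open>
  Choose an open \<open>W \<supseteq> X\<close> of measure less than \<open>(1 + 1 / (n + 1)) \<mu>(X)\<close> and \<open>w\<close> so close to \<open>\<one>\<close>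
  that \<open>w\<inverse> X \<subseteq> W\<close>. Each translate misses less than \<open>\<mu>(X) / (n + 1)\<close> of \<open>W\<close>.
\<close>
lemma common_point_of_translates:
  assumes T: "compact_space T" and X: "closedin T X" "emeasure M X > 0"
  shows "\<exists>U. openin T U \<and> \<one> \<in> U \<and>
    (\<forall>F. finite F \<and> card F \<le> n \<and> F \<subseteq> U \<longrightarrow> (\<exists>x\<in>carrier G. \<forall>w\<in>F. w \<otimes> x \<in> X))"
proof -
  interpret finite_measure M
    by (rule finite_measureI) (simp add: space_eq_carrier normalized)
  define m where "m = measure M X"
  have XG: "X \<subseteq> carrier G"
    using closedin_subset[OF X(1)] topspace_eq_carrier by simp
  have Xm: "emeasure M X = ennreal m"
    by (simp add: m_def emeasure_eq_measure)
  with X(2) have m: "m > 0" by simp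
  define e where "e = m / (n + 1)"
  have e: "e > 0" "n * e < m"
    using m by (auto simp: e_def field_simps)
  have "emeasure M X < ennreal (m + e)"
    using m e by (simp add: Xm ennreal_lessI)
  then obtain W where W: "openin T W" "X \<subseteq> W" "emeasure M W < ennreal (m + e)"
    unfolding outer_regular[OF closedin_sets[OF X(1)]] by (auto simp: INF_less_iff)
  have We: "measure M W < m + e"
    using W(3) m e by (simp add: emeasure_eq_measure ennreal_less_iff del: ennreal_plus)
  have WM: "W \<in> sets M"
    using W(1) by (rule openin_sets)
  have WG: "W \<subseteq> carrier G"
    using openin_subset[OF W(1)] topspace_eq_carrier by simp
  have mW: "m \<le> measure M W"
    unfolding m_def using W(2) WM by (rule finite_measure_mono)
  have "\<exists>U. openin T U \<and> \<one> \<in> U \<and> (\<forall>u\<in>U. \<forall>k\<in>X. inv u \<otimes> k \<in> W)"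
  proof (rule nbhd_one_tube[OF _ closedin_compact_space[OF T X(1)] W(1)])
    show "continuous_map (prod_topology T T) T (\<lambda>(u, k). inv u \<otimes> k)"
      unfolding case_prod_beta by (intro continuous_intros)
  next
    fix k assume "k \<in> X"
    then have "k \<in> carrier G" "k \<in> W"
      using XG W(2) by blast+
    then show "inv \<one> \<otimes> k \<in> W" by simp
  qed
  then obtain U where U: "openin T U" "\<one> \<in> U" "\<And>u k. u \<in> U \<Longrightarrow> k \<in> X \<Longrightarrow> inv u \<otimes> k \<in> W"
    by blast
  have UG: "U \<subseteq> carrier G"
    using openin_subset[OF U(1)] topspace_eq_carrier by simp
  have "\<exists>x\<in>carrier G. \<forall>w\<in>F. w \<otimes> x \<in> X" if F: "finite F" "card F \<le> n" "F \<subseteq> U" for F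
  proof (rule ccontr)
    assume none: "\<not> ?thesis"
    \<comment> \<open>The translate \<open>w^-1 X\<close> consists of the \<open>x\<close> with
      \<open>w x\<close> in \<open>X\<close>; left invariance gives it measure
      \<open>m\<close>.\<close>
    define Y where "Y w = l_coset G (inv w) X" for w
    have Y: "Y w = {x \<in> carrier G. w \<otimes> x \<in> X}" "Y w \<in> sets M" "Y w \<subseteq> W" "measure M (Y w) = m"
      if "w \<in> F" for w
    proof -
      have w: "w \<in> carrier G" "w \<in> U" using that F UG by auto
      show eq: "Y w = {x \<in> carrier G. w \<otimes> x \<in> X}"
        using w XG by (simp add: Y_def l_coset_eq_vimage topspace_eq_carrier)
      have "closedin T {x \<in> topspace T. w \<otimes> x \<in> X}"
        using w X by (intro closedin_continuous_map_preimage[OF continuous_map_left_translate])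
      then show "Y w \<in> sets M"
        unfolding eq by (intro closedin_sets) (simp add: topspace_eq_carrier)
      show "Y w \<subseteq> W"
        using U(3) w by (auto simp: Y_def l_coset_def)
      show "measure M (Y w) = m"
        using left_invariant[of "inv w" X] w closedin_sets[OF X(1)]
        by (simp add: Y_def m_def measure_def)
    qed
    \<comment> \<open>Without a common point of the translates their complements cover
      \<open>W\<close>, whose measure would then be at most \<open>n * e < m\<close>.\<close>
    have "W \<subseteq> (\<Union>w\<in>F. W - Y w)"
      using none WG Y(1) by blast
    then have "measure M W \<le> measure M (\<Union>w\<in>F. W - Y w)"
      using F WM Y by (intro finite_measure_mono sets.finite_UN) auto
    also have "\<dots> \<le> (\<Sum>w\<in>F. measure M (W - Y w))"
      using F WM Y by (intro finite_measure_subadditive_finite) auto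
    also have "\<dots> \<le> (\<Sum>w\<in>F. e)"
      using WM Y We by (intro sum_mono) (simp add: finite_measure_Diff)
    also have "\<dots> \<le> n * e"
      using F e by (simp add: mult_right_mono)
    also have "\<dots> < m" by (rule e)
    finally show False using mW by simp
  qed
  then show ?thesis
    using U by blast
qed

end

section \<open>Construction of the open normal subgroup\<close>

theorem corollary4p5:
  fixes G :: "('a, 'b) monoid_scheme" and T :: "'a topology" and \<mu> :: "'a measure"
  assumes "topological_group G T"
    and "compact_space T"
    and "Hausdorff_space T"
    and "normalized_haar_measure G T \<mu>"
    and "emeasure \<mu> {x \<in> carrier G. x [^]\<^bsub>G\<^esub> (3::nat) = \<one>\<^bsub>G\<^esub>} > 0"
  shows "\<exists>H. H \<lhd> G \<and> openin T H \<and> two_Engel (G\<lparr>carrier := H\<rparr>)"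
proof -
  interpret normalized_haar_measure G T \<mu> by fact
  define X where "X = {x \<in> carrier G. x [^]\<^bsub>G\<^esub> (3::nat) = \<one>\<^bsub>G\<^esub>}"
  have X: "X = {x \<in> topspace T. x \<otimes>\<^bsub>G\<^esub> x \<otimes>\<^bsub>G\<^esub> x \<in> {\<one>\<^bsub>G\<^esub>}}"
    by (auto simp: X_def topspace_eq_carrier numeral_3_eq_3)
  \<comment> \<open>The Hausdorff property makes \<open>{\<one>}\<close> closed, and
    \<open>X\<close> is its preimage under cubing.\<close>
  have "closedin T X"
    unfolding X
  proof (rule closedin_continuous_map_preimage)
    show "continuous_map T T (\<lambda>x. x \<otimes>\<^bsub>G\<^esub> x \<otimes>\<^bsub>G\<^esub> x)"
      by (intro continuous_map_mult) (simp_all flip: id_def)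
    show "closedin T {\<one>\<^bsub>G\<^esub>}"
      using assms(3) by (simp add: closedin_Hausdorff_singleton topspace_eq_carrier)
  qed
  moreover have "emeasure \<mu> X > 0"
    using assms(5) by (simp add: X_def)
  ultimately obtain U where U: "openin T U" "\<one>\<^bsub>G\<^esub> \<in> U"
    and common: "\<forall>F. finite F \<and> card F \<le> 8 \<and> F \<subseteq> U \<longrightarrow>
      (\<exists>x\<in>carrier G. \<forall>w\<in>F. w \<otimes>\<^bsub>G\<^esub> x \<in> X)"
    using common_point_of_translates[OF assms(2), of X 8] by blast
  \<comment> \<open>The eight words of \<open>commute_conj_if_cubes\<close> are products of at most
    two of \<open>u\<close>, \<open>v\<close> and their inverses, hence have length at most 64 when
    \<open>u\<close> and \<open>v\<close> have length 32.\<close>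
  obtain W where W: "openin T W" "\<one>\<^bsub>G\<^esub> \<in> W" "word_ball G W 64 \<subseteq> U"
    using nbhd_one_word_ball[OF U] by blast
  define V where "V = {v \<in> carrier G. \<forall>g\<in>carrier G.
    g \<otimes>\<^bsub>G\<^esub> v \<otimes>\<^bsub>G\<^esub> inv\<^bsub>G\<^esub> g \<in> W \<and> inv\<^bsub>G\<^esub> (g \<otimes>\<^bsub>G\<^esub> v \<otimes>\<^bsub>G\<^esub> inv\<^bsub>G\<^esub> g) \<in> W}"
  note V = nbhd_one_invariant[OF assms(2) W(1,2), folded V_def]
  interpret V: symmetric_subset G V by (rule V(2))
  have ball_U: "V.ball 64 \<subseteq> U"
    using word_ball_mono[OF V(1), of G 64] W(3) by blast
  interpret V: local_two_Engel G V
  proof unfold_locales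
    fix u v assume u: "u \<in> V.ball 32" and v: "v \<in> V.ball 32"
    note [simp] = V.ball_closed[OF u] V.ball_closed[OF v]
    let ?F = "{\<one>\<^bsub>G\<^esub>, u, v, u \<otimes>\<^bsub>G\<^esub> v, inv\<^bsub>G\<^esub> u \<otimes>\<^bsub>G\<^esub> v, inv\<^bsub>G\<^esub> v,
      inv\<^bsub>G\<^esub> v \<otimes>\<^bsub>G\<^esub> inv\<^bsub>G\<^esub> u, inv\<^bsub>G\<^esub> v \<otimes>\<^bsub>G\<^esub> u}"
    note ball = V.ball_mult[of _ 32 _ 32, simplified]
    have "?F \<subseteq> V.ball 64"
      using u v V.ball_mono[of 0 64] V.ball_mono[of 32 64] by (auto intro!: ball V.ball_inv)
    moreover have "card ?F \<le> 8"
      by (intro card_insert_le_m1) simp_all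
    moreover have "finite ?F" by simp
    ultimately have "\<exists>x\<in>carrier G. \<forall>w\<in>?F. w \<otimes>\<^bsub>G\<^esub> x \<in> X"
      using common[THEN spec, of ?F] ball_U by (meson subset_trans)
    then obtain x where "x \<in> carrier G" "\<forall>w\<in>?F. w \<otimes>\<^bsub>G\<^esub> x \<in> X" ..
    then show "inv\<^bsub>G\<^esub> v \<otimes>\<^bsub>G\<^esub> u \<otimes>\<^bsub>G\<^esub> v \<otimes>\<^bsub>G\<^esub> u = u \<otimes>\<^bsub>G\<^esub> (inv\<^bsub>G\<^esub> v \<otimes>\<^bsub>G\<^esub> u \<otimes>\<^bsub>G\<^esub> v)"
      by (intro commute_conj_if_cubes[of x]) (auto simp: X_def)
  qed
  define H where "H = generate G V"
  have sub: "subgroup H G"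
    unfolding H_def by (rule generate_is_subgroup[OF V.subset_carrier])
  have VH: "V \<subseteq> H"
    unfolding H_def using generate.incl by fast
  \<comment> \<open>Conjugation invariance of \<open>V\<close> makes the generated subgroup
    normal.\<close>
  have "H \<lhd> G"
    unfolding H_def using V.subset_carrier V(3) generate.incl
    by (intro normal_generateI) fast+
  moreover have "openin T H"
    using openin_subgroup_if_nbhd[OF sub] V(4) VH by blast
  moreover have "two_Engel (G\<lparr>carrier := H\<rparr>)"
  proof -
    let ?K = "G\<lparr>carrier := H\<rparr>"
    interpret K: group ?K
      using sub subgroup_imp_group by blast
    have com: "commutator ?K a b = commutator G a b" "commutator G a b \<in> H" if "a \<in> H" "b \<in> H" for a b
    proof -
      show "commutator ?K a b = commutator G a b"
        using that by (rule commutator_restrict[OF sub])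
      then show "commutator G a b \<in> H"
        using K.commutator_closed[of a b] that by simp
    qed
    have VH': "v \<in> H" if "v \<in> V" for v
      using that VH by blast
    have b4: "v \<in> V.ball 4" if "v \<in> V" for v
      using V.mem_ball_one[OF that] V.ball_mono[of 1 4] by auto
    show ?thesis
    proof (rule K.two_Engel_if_generators)
      show "V \<subseteq> carrier ?K" using VH by simp
      show "generate ?K V = carrier ?K"
        using generate_consistent[OF VH sub] by (simp add: H_def)
    next
      fix x y z t assume "x \<in> V" "y \<in> V" "z \<in> V" "t \<in> V"
      then show "commutator ?K (commutator ?K (commutator ?K x y) z) t = \<one>\<^bsub>?K\<^esub>"
        using V.quadruple_commutator_eq_one by (simp add: com VH')
    next
      fix x y z assume xyz: "x \<in> V" "y \<in> V" "z \<in> V"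
      then show "commutator ?K (commutator ?K x z) y = inv\<^bsub>?K\<^esub> (commutator ?K (commutator ?K x y) z)"
        using V.triple_swap_23[OF xyz[THEN b4]] by (simp add: com VH' m_inv_consistent[OF sub])
    next
      fix x y assume xy: "x \<in> V" "y \<in> V"
      have "commutator G x y \<otimes>\<^bsub>G\<^esub> y = y \<otimes>\<^bsub>G\<^esub> commutator G x y"
        using V.commutator_commute_snd[OF xy[THEN b4]] .
      then show "commutator ?K (commutator ?K x y) y = \<one>\<^bsub>?K\<^esub>"
        using xy V.subset_carrier by (simp add: com VH' commutator_eq_one_iff subset_iff)
    qed
  qed
  ultimately show ?thesis by blast
qed

end
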